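(* Let $K$ be a finite simplicial complex and $v$ a vertex of $K$. The one-point suspension $\operatorname{Susp}_1(v,K)$ is shellable if and only if $K$ is shellable.
   Context: Simplicial complexes are finite abstract simplicial complexes; the empty set is a face. A complex is pure if all its maximal faces (facets) have the same dimension. For a vertex $v$ of $K$: $\operatorname{link}_K(v)=\{F\in K: v\notin F,\ \{v\}\cup F\in K\}$ and $\operatorname{star}_K(v)=\{F\in K: v\in F\}$ (a set of faces). For sets of faces $A,B$ on disjoint vertex sets, $A*B=\{F\cup G: F\in A, G\in B\}$. One-point suspension: let $v',v''$ be two new vertices (copies of $v$) not in $K$, let $\overline{v'v''}$ be the edge (full simplex) they span and $\partial\,\overline{v'v''}=\{\emptyset,\{v'\},\{v''\}\}$. Then $$\operatorname{Susp}_1(v,K)=\bigl((\partial\,\overline{v'v''}*K)\setminus(\partial\,\overline{v'v''}*\operatorname{star}_K(v))\bigr)\cup\bigl(\overline{v'v''}*\operatorname{link}_K(v)\bigr).$$ Shellable: a complex $L$ is shellable if it is pure, say of dimension $m$, and its facets can be linearly ordered $F_1,\dots,F_t$ such that for every $2\le k\le t$ the complex $(2^{F_1}\cup\dots\cup2^{F_{k-1}})\cap 2^{F_k}$ is pure of dimension $m-1$, where $2^F$ denotes the set of all faces of the simplex $F$. *)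

theory Defs
  imports Main
begin

definition simplicial_complex :: "'a set set \<Rightarrow> bool" where
  "simplicial_complex K \<longleftrightarrow>
     finite K \<and> {} \<in> K \<and> (\<forall>F\<in>K. finite F) \<and> (\<forall>F\<in>K. \<forall>G. G \<subseteq> F \<longrightarrow> G \<in> K)"

definition facets :: "'a set set \<Rightarrow> 'a set set" where
  "facets K = {F \<in> K. \<forall>G\<in>K. F \<subseteq> G \<longrightarrow> G = F}"

(* Integer-valued, so that the empty face has dimension -1. *)
definition face_dim :: "'a set \<Rightarrow> int" where
  "face_dim F = int (card F) - 1"

definition pure_of_dim :: "int \<Rightarrow> 'a set set \<Rightarrow> bool" where
  "pure_of_dim m K \<longleftrightarrow> (\<forall>F\<in>facets K. face_dim F = m)"

definition vertex_link :: "'a set set \<Rightarrow> 'a \<Rightarrow> 'a set set" where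
  "vertex_link K v = {F \<in> K. v \<notin> F \<and> {v} \<union> F \<in> K}"

(* The open star: a set of faces, in general not a subcomplex. *)
definition vertex_star :: "'a set set \<Rightarrow> 'a \<Rightarrow> 'a set set" where
  "vertex_star K v = {F \<in> K. v \<in> F}"

definition face_join :: "'a set set \<Rightarrow> 'a set set \<Rightarrow> 'a set set" (infixr "\<star>" 75) where
  "A \<star> B = {F \<union> G | F G. F \<in> A \<and> G \<in> B}"

definition edge :: "'a \<Rightarrow> 'a \<Rightarrow> 'a set set" where
  "edge v' v'' = Pow {v', v''}"

definition edge_boundary :: "'a \<Rightarrow> 'a \<Rightarrow> 'a set set" where
  "edge_boundary v' v'' = {{}, {v'}, {v''}}"

(* The two copies v' and v'' of v are explicit arguments; the definition is
   meaningful when they are distinct and not vertices of K. *)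
definition one_point_suspension :: "'a \<Rightarrow> 'a \<Rightarrow> 'a \<Rightarrow> 'a set set \<Rightarrow> 'a set set" where
  "one_point_suspension v' v'' v K =
     ((edge_boundary v' v'' \<star> K) - (edge_boundary v' v'' \<star> vertex_star K v))
       \<union> (edge v' v'' \<star> vertex_link K v)"

(* Positions are counted from 0, so the condition on the k-th facet for k \<ge> 2
   becomes one on Fs ! k for k \<ge> 1. *)
definition shellable :: "'a set set \<Rightarrow> bool" where
  "shellable L \<longleftrightarrow>
     (\<exists>m. pure_of_dim m L \<and>
       (\<exists>Fs. distinct Fs \<and> set Fs = facets L \<and>
         (\<forall>k. 1 \<le> k \<and> k < length Fs \<longrightarrow>
           pure_of_dim (m - 1) ((\<Union>j<k. Pow (Fs ! j)) \<inter> Pow (Fs ! k)))))"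

end

theory Submission
  imports Defs
begin

text \<open>
  Write \<open>S\<close> for the one-point suspension. A facet \<open>F\<close> of \<open>K\<close> gives rise to the single facet
  \<open>(F - {v}) \<union> {v', v''}\<close> of \<open>S\<close> if \<open>v \<in> F\<close>, and to the two facets \<open>F \<union> {v'}\<close> and
  \<open>F \<union> {v''}\<close> otherwise. Replacing every facet in a shelling of \<open>K\<close> by its copies gives a
  shelling of \<open>S\<close>. Conversely, the link of \<open>v'\<close> in \<open>S\<close> is \<open>K\<close> with \<open>v\<close> renamed to \<open>v''\<close>, and
  a shelling of a complex restricts to a shelling of each vertex link.
\<close>

section \<open>Shellings as lists satisfying an exchange condition\<close>

text \<open>The exchange form of the shelling condition, with codimension one expressed by
  cardinalities, so that no global dimension appears. It depends only on the set of earlier facets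
  and is vacuous when there are none.\<close>

definition attaches :: "'a set set \<Rightarrow> 'a set \<Rightarrow> bool" where
  "attaches S F \<longleftrightarrow> (\<forall>A\<in>S. \<exists>B\<in>S. A \<inter> F \<subseteq> B \<and> card (B \<inter> F) + 1 = card F)"

definition shelling :: "'a set list \<Rightarrow> bool" where
  "shelling Fs \<longleftrightarrow> (\<forall>k<length Fs. attaches (set (take k Fs)) (Fs ! k))"

lemma shelling_Nil [simp]: "shelling []"
  by (simp add: shelling_def)

lemma shelling_snoc [simp]: "shelling (Fs @ [F]) \<longleftrightarrow> shelling Fs \<and> attaches (set Fs) F"
  by (auto simp: shelling_def nth_append less_Suc_eq)

lemma facetsI: "F \<in> L \<Longrightarrow> (\<And>G. G \<in> L \<Longrightarrow> F \<subseteq> G \<Longrightarrow> G = F) \<Longrightarrow> F \<in> facets L"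
  by (simp add: facets_def)

text \<open>Every face of the intersection complex lies in a trace \<open>A \<inter> F\<close>, so
  its facets are the maximal traces. Purity says that these have codimension one in
  \<open>F\<close>; by finiteness every trace lies in a maximal one.\<close>

lemma attaches_iff_pure:
  assumes "finite S" "finite F" "face_dim F = m"
  shows "attaches S F \<longleftrightarrow> pure_of_dim (m - 1) ((\<Union>A\<in>S. Pow A) \<inter> Pow F)"
    (is "_ \<longleftrightarrow> pure_of_dim _ ?C")
proof
  assume att: "attaches S F"
  show "pure_of_dim (m - 1) ?C"
    unfolding pure_of_dim_def
  proof
    fix H assume H: "H \<in> facets ?C"
    then obtain A where A: "A \<in> S" "H \<subseteq> A" "H \<subseteq> F"
      by (auto simp: facets_def)
    with att obtain B where B: "B \<in> S" "A \<inter> F \<subseteq> B" "card (B \<inter> F) + 1 = card F"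
      by (auto simp: attaches_def)
    have "B \<inter> F \<in> ?C" "H \<subseteq> B \<inter> F" using A B by auto
    with H have "H = B \<inter> F" unfolding facets_def by blast
    with B assms show "face_dim H = m - 1" by (auto simp: face_dim_def)
  qed
next
  assume pure: "pure_of_dim (m - 1) ?C"
  show "attaches S F"
    unfolding attaches_def
  proof
    fix A assume "A \<in> S"
    then have "A \<inter> F \<in> ?C" by auto
    moreover have "finite ?C" using assms by auto
    ultimately obtain H where H: "H \<in> ?C" "A \<inter> F \<subseteq> H" "\<And>G. G \<in> ?C \<Longrightarrow> H \<subseteq> G \<Longrightarrow> G = H"
      using finite_has_maximal2[of ?C "A \<inter> F"] by metis
    then obtain B where B: "B \<in> S" "H \<subseteq> B" "H \<subseteq> F" by auto
    then have "B \<inter> F \<in> ?C" "H \<subseteq> B \<inter> F" by auto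
    \<comment> \<open>The maximal face is itself the trace of some \<open>B\<close>, and this
      \<open>B\<close> is the required witness.\<close>
    then have "B \<inter> F = H" by (rule H(3))
    moreover have "H \<in> facets ?C" using H(1,3) by (rule facetsI)
    with pure have "face_dim H = m - 1" by (simp add: pure_of_dim_def)
    ultimately show "\<exists>B\<in>S. A \<inter> F \<subseteq> B \<and> card (B \<inter> F) + 1 = card F"
      using B H(2) assms(3) by (intro bexI[of _ B]) (auto simp: face_dim_def)
  qed
qed

text \<open>Once purity fixes the dimension of all facets, the ordering condition no longer mentions
  \<open>m\<close>, so purity and ordering can be transferred separately.\<close>

lemma shellable_iff_shelling:
  assumes "\<And>F. F \<in> L \<Longrightarrow> finite F"
  shows "shellable L \<longleftrightarrow>
    (\<exists>m. pure_of_dim m L) \<and> (\<exists>Fs. distinct Fs \<and> set Fs = facets L \<and> shelling Fs)"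
proof -
  have eq: "(\<forall>k. 1 \<le> k \<and> k < length Fs \<longrightarrow>
      pure_of_dim (m - 1) ((\<Union>j<k. Pow (Fs ! j)) \<inter> Pow (Fs ! k))) \<longleftrightarrow> shelling Fs"
    if Fs: "set Fs = facets L" and m: "pure_of_dim m L" for m Fs
  proof -
    have "pure_of_dim (m - 1) ((\<Union>j<k. Pow (Fs ! j)) \<inter> Pow (Fs ! k))
        \<longleftrightarrow> attaches (set (take k Fs)) (Fs ! k)" if "k < length Fs" for k
    proof -
      have *: "Fs ! k \<in> facets L" using nth_mem[OF that] unfolding Fs .
      then have "finite (Fs ! k)" using assms by (auto simp: facets_def)
      moreover have "(\<Union>j<k. Pow (Fs ! j)) = (\<Union>A\<in>set (take k Fs). Pow A)"
        using that by (simp flip: nth_image add: atLeast0LessThan)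
      ultimately show ?thesis
        using * m by (simp add: attaches_iff_pure[where m = m] pure_of_dim_def)
    qed
    \<comment> \<open>\<open>shelling\<close> also quantifies over position 0, which
      \<open>shellable\<close> leaves out; there the condition is vacuous.\<close>
    moreover have "attaches (set (take 0 Fs)) (Fs ! 0)" by (simp add: attaches_def)
    ultimately show ?thesis
      unfolding shelling_def by (metis less_one not_le)
  qed
  then show ?thesis
    unfolding shellable_def by metis
qed

section \<open>Restricting and relabelling shellings\<close>

text \<open>If \<open>x\<close> lies in both \<open>A\<close> and \<open>F\<close>, then it lies in
  \<open>A \<inter> F \<subseteq> B\<close>, so the witness \<open>B\<close> survives the
  filter.\<close>

lemma shelling_filter_mem: "shelling Fs \<Longrightarrow> shelling (filter (\<lambda>F. x \<in> F) Fs)"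
  by (induction Fs rule: rev_induct) (fastforce simp: attaches_def)+

lemma attaches_Diff_vertex:
  assumes "attaches S F" "\<forall>A\<in>S. x \<in> A" "x \<in> F" "finite F"
  shows "attaches ((\<lambda>A. A - {x}) ` S) (F - {x})"
proof -
  have card: "card ((B - {x}) \<inter> (F - {x})) + 1 = card (F - {x})"
    if "B \<in> S" "card (B \<inter> F) + 1 = card F" for B
  proof -
    have "(B - {x}) \<inter> (F - {x}) = B \<inter> F - {x}" by auto
    moreover have "x \<in> B \<inter> F" using that assms by auto
    \<comment> \<open>Positivity makes subtracting one and adding it back exact on natural
      numbers.\<close>
    moreover from this have "card (B \<inter> F) > 0" using assms(4) by (auto simp: card_gt_0_iff)
    ultimately show ?thesis using that assms by simp
  qed
  show ?thesis
    unfolding attaches_def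
  proof clarify
    fix A assume "A \<in> S"
    with assms(1) obtain B where B: "B \<in> S" "A \<inter> F \<subseteq> B" "card (B \<inter> F) + 1 = card F"
      by (auto simp: attaches_def)
    then have "(A - {x}) \<inter> (F - {x}) \<subseteq> B - {x}" by auto
    with B card[OF B(1,3)]
    show "\<exists>B\<in>(\<lambda>A. A - {x}) ` S. (A - {x}) \<inter> (F - {x}) \<subseteq> B \<and> card (B \<inter> (F - {x})) + 1 = card (F - {x})"
      by blast
  qed
qed

lemma attaches_image:
  assumes "attaches S F" "inj_on f V" "F \<subseteq> V" "\<forall>A\<in>S. A \<subseteq> V"
  shows "attaches ((`) f ` S) (f ` F)"
proof -
  have int: "f ` A \<inter> f ` F = f ` (A \<inter> F)" if "A \<in> S" for A
    using inj_on_image_Int[OF assms(2), of A F] assms that by auto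
  have card: "card (f ` A) = card A" if "A \<subseteq> F" for A
    using assms that by (meson card_image inj_on_subset subset_trans)
  show ?thesis
    unfolding attaches_def
  proof clarify
    fix A assume "A \<in> S"
    then obtain B where B: "B \<in> S" "A \<inter> F \<subseteq> B" "card (B \<inter> F) + 1 = card F"
      using assms(1) by (auto simp: attaches_def)
    then show "\<exists>B\<in>(`) f ` S. f ` A \<inter> f ` F \<subseteq> B \<and> card (B \<inter> f ` F) + 1 = card (f ` F)"
      using \<open>A \<in> S\<close> by (intro bexI[of _ "f ` B"]) (auto simp: int card)
  qed
qed

lemma shelling_map:
  assumes "shelling Fs"
    and "\<And>S F. attaches S F \<Longrightarrow> S \<subseteq> set Fs \<Longrightarrow> F \<in> set Fs \<Longrightarrow> attaches (g ` S) (g F)"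
  shows "shelling (map g Fs)"
  using assms by (induction Fs rule: rev_induct) auto

section \<open>Faces and facets of the one-point suspension\<close>

locale suspension_data =
  fixes K :: "'a set set" and v v' v'' :: 'a
  assumes complex: "simplicial_complex K"
    and vertex: "{v} \<in> K"
    and fresh: "v' \<notin> \<Union>K" "v'' \<notin> \<Union>K" "v' \<noteq> v''"
begin

abbreviation "S \<equiv> one_point_suspension v' v'' v K"

lemma finite_face: "F \<in> K \<Longrightarrow> finite F"
  and down_closed: "F \<in> K \<Longrightarrow> G \<subseteq> F \<Longrightarrow> G \<in> K"
  using complex by (auto simp: simplicial_complex_def)

lemma fresh_face: "F \<in> K \<Longrightarrow> v' \<notin> F" "F \<in> K \<Longrightarrow> v'' \<notin> F"
  using fresh by auto

lemma v_neq: "v \<noteq> v'" "v \<noteq> v''" "v' \<noteq> v" "v'' \<noteq> v"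
  using fresh vertex by auto

text \<open>Faces of \<open>K\<close> avoid both copies, so a face of the suspension splits uniquely
  into a part inside \<open>{v', v''}\<close> and a face of \<open>K\<close>. Removing the join with
  the star excludes \<open>v\<close> from the latter; both copies can occur only over the
  link.\<close>

lemma mem_suspension_iff:
  "X \<in> S \<longleftrightarrow> v \<notin> X \<and> X - {v', v''} \<in> K \<and>
     (v' \<in> X \<and> v'' \<in> X \<longrightarrow> insert v (X - {v', v''}) \<in> K)" (is "?L \<longleftrightarrow> ?R")
proof
  have diff: "E \<union> G - {v', v''} = G" if "E \<subseteq> {v', v''}" "G \<in> K" for E G
    using that fresh_face[OF that(2)] by auto
  assume L: ?L
  consider
    (boundary) E G where "X = E \<union> G" "E \<in> {{}, {v'}, {v''}}" "G \<in> K"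
      "X \<notin> edge_boundary v' v'' \<star> vertex_star K v"
  | (link) E G where "X = E \<union> G" "E \<subseteq> {v', v''}" "G \<in> K" "v \<notin> G" "insert v G \<in> K"
  proof (cases "X \<in> edge v' v'' \<star> vertex_link K v")
    case True
    then show ?thesis
      using link by (auto simp: face_join_def edge_def vertex_link_def)
  next
    case False
    with L have "X \<in> edge_boundary v' v'' \<star> K" "X \<notin> edge_boundary v' v'' \<star> vertex_star K v"
      by (simp_all add: one_point_suspension_def)
    then show ?thesis
      using boundary unfolding face_join_def edge_boundary_def by blast
  qed
  then show ?R
  proof cases
    case boundary
    then have "v \<notin> G"
      unfolding face_join_def edge_boundary_def vertex_star_def by blast
    moreover have "X - {v', v''} = G" using diff[of E G] boundary by auto
    ultimately show ?thesis
      using boundary fresh fresh_face[OF boundary(3)] v_neq by auto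
  next
    case link
    then show ?thesis using diff[of E G] v_neq by auto
  qed
next
  assume R: ?R
  let ?G = "X - {v', v''}"
  have X: "X = (X \<inter> {v', v''}) \<union> ?G" by auto
  show ?L
  proof (cases "v' \<in> X \<and> v'' \<in> X")
    case True
    then have "?G \<in> vertex_link K v" using R by (auto simp: vertex_link_def)
    with X show ?thesis
      unfolding one_point_suspension_def face_join_def edge_def by blast
  next
    case False
    then have "X \<inter> {v', v''} \<in> edge_boundary v' v''" by (auto simp: edge_boundary_def)
    then have "X \<in> edge_boundary v' v'' \<star> K" using X R unfolding face_join_def by blast
    moreover have "X \<notin> edge_boundary v' v'' \<star> vertex_star K v"
      using R unfolding face_join_def vertex_star_def by auto
    ultimately show ?thesis by (simp add: one_point_suspension_def)
  qed
qed

text \<open>A list rather than a set, so that a shelling of the suspension can be assembled with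
  \<open>concat\<close>.\<close>

definition copies :: "'a set \<Rightarrow> 'a set list" where
  "copies F = (if v \<in> F then [insert v' (insert v'' (F - {v}))] else [insert v' F, insert v'' F])"

lemma copies_subset_facets:
  assumes F: "F \<in> facets K"
  shows "set (copies F) \<subseteq> facets S"
proof -
  have FK: "F \<in> K" and max: "\<And>G. G \<in> K \<Longrightarrow> F \<subseteq> G \<Longrightarrow> G = F"
    using F by (auto simp: facets_def)
  note fr = fresh_face[OF FK]
  show ?thesis
  proof (cases "v \<in> F")
    case True
    let ?X = "insert v' (insert v'' (F - {v}))"
    have eq: "?X - {v', v''} = F - {v}" "insert v (F - {v}) = F" using fr True by auto
    have "?X \<in> S"
      unfolding mem_suspension_iff eq using FK down_closed[OF FK, of "F - {v}"] v_neq by auto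
    moreover have "Y = ?X" if Y: "Y \<in> S" "?X \<subseteq> Y" for Y
    proof -
      have "v \<notin> Y" "insert v (Y - {v', v''}) = F"
        using Y fr True by (auto simp: mem_suspension_iff intro!: max)
      then have "Y - {v', v''} = F - {v}" by auto
      then show ?thesis using Y by auto
    qed
    ultimately have "?X \<in> facets S" by (rule facetsI)
    with True show ?thesis by (simp add: copies_def)
  next
    case False
    have "insert x F \<in> facets S" if x: "x = v' \<or> x = v''" for x
    proof -
      have eq: "insert x F - {v', v''} = F" using fr x by auto
      have "insert x F \<in> S"
        unfolding mem_suspension_iff eq using FK x False v_neq fr fresh by auto
      moreover have "Y = insert x F" if Y: "Y \<in> S" "insert x F \<subseteq> Y" for Y
      proof -
        have "Y - {v', v''} = F" using Y fr by (intro max) (auto simp: mem_suspension_iff)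
        \<comment> \<open>Since \<open>v\<close> cannot be added to \<open>F\<close>, the face
          \<open>Y\<close> cannot contain both copies.\<close>
        moreover have "insert v F \<notin> K" using max[of "insert v F"] False by auto
        ultimately show ?thesis using Y x by (auto simp: mem_suspension_iff)
      qed
      ultimately show ?thesis by (rule facetsI)
    qed
    then show ?thesis using False by (simp add: copies_def)
  qed
qed

text \<open>A face \<open>H\<close> of \<open>K\<close> above the candidate facet lifts to a face of
  the suspension above \<open>X\<close>, where maximality of \<open>X\<close> applies.\<close>

lemma facet_is_copy:
  assumes X: "X \<in> facets S"
  shows "\<exists>F\<in>facets K. X \<in> set (copies F)"
proof -
  let ?G = "X - {v', v''}"
  have XS: "v \<notin> X" "?G \<in> K" "v' \<in> X \<Longrightarrow> v'' \<in> X \<Longrightarrow> insert v ?G \<in> K"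
    and max: "\<And>Y. Y \<in> S \<Longrightarrow> X \<subseteq> Y \<Longrightarrow> Y = X"
    using X by (auto simp: facets_def mem_suspension_iff)
  show ?thesis
  proof (cases "v' \<in> X \<and> v'' \<in> X")
    case True
    have "insert v ?G \<in> facets K"
    proof (rule facetsI)
      show "insert v ?G \<in> K" using XS True by auto
      fix H assume H: "H \<in> K" "insert v ?G \<subseteq> H"
      have eq: "insert v' (insert v'' (H - {v})) - {v', v''} = H - {v}" "insert v (H - {v}) = H"
        using H fresh_face[OF H(1)] by auto
      have "insert v' (insert v'' (H - {v})) = X"
        by (rule max, unfold mem_suspension_iff eq)
          (use H XS v_neq down_closed[OF H(1), of "H - {v}"] in auto)
      then show "H = insert v ?G" using eq by auto
    qed
    moreover have "X \<in> set (copies (insert v ?G))" using True XS by (auto simp: copies_def)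
    ultimately show ?thesis by blast
  next
    case False
    \<comment> \<open>Otherwise both copies could be added to \<open>X\<close>.\<close>
    have not_link: "insert v ?G \<notin> K"
    proof
      assume ins: "insert v ?G \<in> K"
      have eq: "insert v' (insert v'' X) - {v', v''} = ?G" by auto
      have "insert v' (insert v'' X) = X"
        by (rule max, unfold mem_suspension_iff eq) (use ins XS v_neq in auto)
      with False show False by auto
    qed
    \<comment> \<open>Otherwise \<open>v'\<close> could be added to \<open>X\<close>.\<close>
    have one: "v' \<in> X \<or> v'' \<in> X"
    proof (rule ccontr)
      assume none: "\<not> ?thesis"
      have eq: "insert v' X - {v', v''} = ?G" using none by auto
      have "insert v' X = X"
        by (rule max, unfold mem_suspension_iff eq) (use none fresh XS v_neq in auto)
      with none show False by auto
    qed
    have "?G \<in> facets K"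
    proof (rule facetsI)
      show "?G \<in> K" by (rule XS)
      fix H assume H: "H \<in> K" "?G \<subseteq> H"
      have "v \<notin> H" using not_link down_closed[OF H(1), of "insert v ?G"] H by auto
      have eq: "H \<union> (X \<inter> {v', v''}) - {v', v''} = H" using fresh_face[OF H(1)] by auto
      have "H \<union> (X \<inter> {v', v''}) = X"
        by (rule max, unfold mem_suspension_iff eq)
          (use False H \<open>v \<notin> H\<close> v_neq fresh_face[OF H(1)] in auto)
      then show "H = ?G" using eq by auto
    qed
    moreover have "X \<in> set (copies ?G)" using one False XS by (auto simp: copies_def)
    ultimately show ?thesis by blast
  qed
qed

lemma facets_suspension: "facets S = (\<Union>F\<in>facets K. set (copies F))"
proof
  show "facets S \<subseteq> (\<Union>F\<in>facets K. set (copies F))"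
    using facet_is_copy by (intro subsetI UN_iff[THEN iffD2])
  show "(\<Union>F\<in>facets K. set (copies F)) \<subseteq> facets S"
    by (rule UN_least) (rule copies_subset_facets)
qed

section \<open>Dimension and purity\<close>

lemma finite_face_suspension: "X \<in> S \<Longrightarrow> finite X"
  using finite_face[of "X - {v', v''}"] by (auto simp: mem_suspension_iff)

lemma card_copy:
  assumes "F \<in> K" "X \<in> set (copies F)"
  shows "card X = card F + 1"
proof -
  have "card F > 0" if "v \<in> F" using that assms finite_face by (auto simp: card_gt_0_iff)
  then show ?thesis
    using assms fresh_face[OF assms(1)] finite_face[OF assms(1)] fresh
    by (auto simp: copies_def split: if_splits)
qed

lemma pure_suspension: "pure_of_dim (m + 1) S \<longleftrightarrow> pure_of_dim m K"
proof -
  have dim: "face_dim X = face_dim F + 1" if "F \<in> facets K" "X \<in> set (copies F)" for F X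
    using that card_copy[of F X] by (auto simp: facets_def face_dim_def)
  have "pure_of_dim (m + 1) S \<longleftrightarrow> (\<forall>F\<in>facets K. \<forall>X\<in>set (copies F). face_dim X = m + 1)"
    by (simp add: pure_of_dim_def facets_suspension)
  also have "\<dots> \<longleftrightarrow> (\<forall>F\<in>facets K. \<forall>X\<in>set (copies F). face_dim F = m)"
    by (intro ball_cong refl) (simp add: dim)
  \<comment> \<open>The inner quantifier disappears because \<open>copies F\<close> is never
    empty.\<close>
  also have "\<dots> \<longleftrightarrow> pure_of_dim m K"
    unfolding pure_of_dim_def by (intro ball_cong refl) (auto simp: copies_def)
  finally show ?thesis .
qed

section \<open>From a shelling of the complex to one of the suspension\<close>

text \<open>This lifts the exchange condition: a witness \<open>B\<close> for \<open>A\<close> and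
  \<open>F\<close> yields a copy of \<open>B\<close> that is a witness for the given copies, since
  the intersection gains one vertex just as each facet does.\<close>

lemma copy_Int:
  assumes "A \<in> K" "B \<in> K" "F \<in> K" "A \<inter> F \<subseteq> B" "X \<in> set (copies A)" "Y \<in> set (copies F)"
  shows "\<exists>Z\<in>set (copies B). X \<inter> Y \<subseteq> Z \<and> card (Z \<inter> Y) = card (B \<inter> F) + 1"
proof -
  note fr = fresh_face[OF assms(1)] fresh_face[OF assms(2)] fresh_face[OF assms(3)]
  have BF: "B \<inter> F \<in> K" using assms down_closed by blast
  have card: "card (insert x (B \<inter> F)) = card (B \<inter> F) + 1" if "x = v' \<or> x = v''" for x
    using that finite_face[OF BF] fr by auto
  show ?thesis
  proof (cases "v \<in> B")
    case True
    let ?Z = "insert v' (insert v'' (B - {v}))"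
    have Z: "?Z \<in> set (copies B)" using True by (simp add: copies_def)
    have sub: "X \<inter> Y \<subseteq> ?Z"
      using assms fr by (auto simp: copies_def split: if_splits)
    show ?thesis
    proof (cases "v \<in> F")
      case vF: True
      then have "?Z \<inter> Y = insert v' (insert v'' (B \<inter> F - {v}))" 
        using assms by (auto simp: copies_def)
      \<comment> \<open>As \<open>v\<close> lies in both \<open>B\<close> and \<open>F\<close>, the
        intersection is the copy of \<open>B \<inter> F\<close>, whose size is known.\<close>
      moreover have "insert v' (insert v'' (B \<inter> F - {v})) \<in> set (copies (B \<inter> F))"
        using True vF by (simp add: copies_def)
      ultimately have "card (?Z \<inter> Y) = card (B \<inter> F) + 1" using card_copy[OF BF] by simp
      with Z sub show ?thesis by (intro bexI conjI)
    next
      case False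
      then obtain x where x: "x = v' \<or> x = v''" "Y = insert x F"
        using assms by (auto simp: copies_def)
      then have "?Z \<inter> Y = insert x (B \<inter> F)" using False fr by auto
      with card[OF x(1)] have "card (?Z \<inter> Y) = card (B \<inter> F) + 1" by (simp only:)
      with Z sub show ?thesis by (intro bexI conjI)
    qed
  next
    case False
    then have nv: "v \<notin> A \<or> v \<notin> F" using assms by auto
    \<comment> \<open>Here \<open>B\<close> has two copies and the right one must be chosen. One of
      \<open>A\<close> and \<open>F\<close> misses \<open>v\<close>, so its given copy contains just
      one of \<open>v'\<close> and \<open>v''\<close>; that vertex is \<open>x\<close>.\<close>
    obtain x where x: "x = v' \<or> x = v''" "x \<in> Y" "X \<inter> Y \<subseteq> insert x B"
    proof (cases "v \<in> F")
      case True
      then obtain x where x: "x = v' \<or> x = v''" "X = insert x A"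
        using assms nv by (auto simp: copies_def)
      have Y: "Y = insert v' (insert v'' (F - {v}))" using True assms by (simp add: copies_def)
      have "x \<in> Y" "X \<inter> Y \<subseteq> insert x B" using x Y fr assms(4) by auto
      with x show ?thesis by (intro that)
    next
      case False
      then obtain x where x: "x = v' \<or> x = v''" "Y = insert x F"
        using assms by (auto simp: copies_def)
      moreover have "X \<subseteq> A \<union> {v', v''}"
        using assms by (auto simp: copies_def split: if_splits)
      ultimately have "x \<in> Y" "X \<inter> Y \<subseteq> insert x B" using fr assms(4) by auto
      with x show ?thesis by (intro that)
    qed
    have "insert x B \<inter> Y = insert x (B \<inter> F)"
      using x(1,2) assms(6) fr False by (auto simp: copies_def split: if_splits)
    with card[OF x(1)] have "card (insert x B \<inter> Y) = card (B \<inter> F) + 1" by (simp only:)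
    moreover have "insert x B \<in> set (copies B)" using False x(1) by (auto simp: copies_def)
    ultimately show ?thesis using x(3) by (intro bexI conjI)
  qed
qed

lemma attaches_copies:
  assumes "attaches T F" "T \<subseteq> K" "F \<in> K" "Y \<in> set (copies F)"
  shows "attaches (\<Union>A\<in>T. set (copies A)) Y"
  unfolding attaches_def
proof
  fix X assume "X \<in> (\<Union>A\<in>T. set (copies A))"
  then obtain A where A: "A \<in> T" "X \<in> set (copies A)" by auto
  with assms obtain B where B: "B \<in> T" "A \<inter> F \<subseteq> B" "card (B \<inter> F) + 1 = card F"
    by (auto simp: attaches_def)
  with A assms obtain Z where "Z \<in> set (copies B)" "X \<inter> Y \<subseteq> Z" "card (Z \<inter> Y) = card (B \<inter> F) + 1"
    using copy_Int[of A B F X Y] by blast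
  with B card_copy[OF assms(3,4)]
  show "\<exists>Z\<in>\<Union>A\<in>T. set (copies A). X \<inter> Y \<subseteq> Z \<and> card (Z \<inter> Y) + 1 = card Y" by auto
qed

lemma shelling_copies:
  assumes "shelling Fs" "set Fs \<subseteq> K"
  shows "shelling (concat (map copies Fs))"
  using assms
proof (induction Fs rule: rev_induct)
  case (snoc F Fs)
  let ?T = "\<Union>A\<in>set Fs. set (copies A)"
  have sh: "shelling (concat (map copies Fs))" using snoc by auto
  have F: "F \<in> K" and att: "\<And>Y. Y \<in> set (copies F) \<Longrightarrow> attaches ?T Y"
    using snoc.prems attaches_copies[of "set Fs" F] by auto
  show ?case
  proof (cases "v \<in> F")
    case True
    then show ?thesis using sh att by (simp add: copies_def[of F])
  next
    case False
    have int: "insert v' F \<inter> insert v'' F = F" using fresh fresh_face[OF F] by auto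
    have card: "card (insert v'' F) = card F + 1"
      using fresh_face[OF F] finite_face[OF F] by simp
    have "attaches ?T (insert v'' F)" using att False by (simp add: copies_def)
    \<comment> \<open>The new earlier facet \<open>insert v' F\<close> is its own witness: it meets
      \<open>insert v'' F\<close> exactly in \<open>F\<close>, which has codimension one.\<close>
    then have "attaches (insert (insert v' F) ?T) (insert v'' F)"
      using int card unfolding attaches_def by auto
    moreover have "attaches ?T (insert v' F)" using att False by (simp add: copies_def)
    ultimately show ?thesis
      using False sh shelling_snoc[of "concat (map copies Fs) @ [insert v' F]" "insert v'' F"]
      by (simp add: copies_def[of F])
  qed
qed simp

lemma distinct_copies:
  assumes "distinct Fs" "set Fs \<subseteq> K"
  shows "distinct (concat (map copies Fs))"
proof -
  have dis: "distinct (copies F)" if "F \<in> K" for F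
    using fresh fresh_face[OF that] by (auto simp: copies_def)
  have disj: "F = G" if "F \<in> K" "G \<in> K" "X \<in> set (copies F)" "X \<in> set (copies G)" for F G X
  proof -
    \<comment> \<open>The original facet can be read off from any copy: \<open>v\<close> was present
      exactly when both new vertices are.\<close>
    have "F = (if v' \<in> X \<and> v'' \<in> X then insert v (X - {v', v''}) else X - {v', v''})"
      if "F \<in> K" "X \<in> set (copies F)" for F
      using that fresh fresh_face[OF that(1)] by (auto simp: copies_def split: if_splits)
    with that show ?thesis by metis
  qed
  from assms show ?thesis
  proof (induction Fs)
    case (Cons F Fs)
    then have "set (copies F) \<inter> (\<Union>G\<in>set Fs. set (copies G)) = {}"
      using disj[of F] by fastforce
    with Cons dis show ?case by auto
  qed simp
qed

section \<open>From a shelling of the suspension back to the complex\<close>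

text \<open>For faces through \<open>v'\<close>: deleting \<open>v'\<close> passes to its link, and
  the renaming identifies that link with \<open>K\<close>.\<close>

definition restore :: "'a set \<Rightarrow> 'a set" where
  "restore X = (\<lambda>x. if x = v'' then v else x) ` (X - {v'})"

lemma restore_copy:
  assumes "F \<in> K" "X \<in> set (copies F)" "v' \<in> X"
  shows "restore X = F"
proof (cases "v \<in> F")
  case True
  then have X: "X - {v'} = insert v'' (F - {v})"
    using assms fresh_face[OF assms(1)] fresh by (auto simp: copies_def)
  show ?thesis
    unfolding restore_def X using True fresh_face[OF assms(1)] by auto
next
  case False
  then have X: "X - {v'} = F"
    using assms fresh_face[OF assms(1)] fresh by (auto simp: copies_def)
  show ?thesis
    unfolding restore_def X using fresh_face[OF assms(1)] by auto
qed

text \<open>Each facet of \<open>K\<close> has exactly one copy through \<open>v'\<close>.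
  Injectivity keeps the restored list distinct.\<close>

lemma restore_facets:
  "bij_betw restore {X \<in> facets S. v' \<in> X} (facets K)"
proof (rule bij_betw_imageI)
  have K: "F \<in> K" if "F \<in> facets K" for F using that by (simp add: facets_def)
  have v': "\<exists>X\<in>set (copies F). v' \<in> X" for F by (simp add: copies_def)
  show "restore ` {X \<in> facets S. v' \<in> X} = facets K"
    unfolding facets_suspension using K v' restore_copy by (fastforce simp: image_iff)
  have "X = Y" if "v' \<in> X" "v' \<in> Y" "X \<in> set (copies F)" "Y \<in> set (copies F)" "F \<in> K" for X Y F
    using that fresh fresh_face[OF that(5)] by (auto simp: copies_def split: if_splits)
  with restore_copy K show "inj_on restore {X \<in> facets S. v' \<in> X}"
    unfolding facets_suspension inj_on_def by clarsimp metis
qed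

lemma attaches_restore:
  assumes "attaches T F" "T \<subseteq> {X \<in> S. v' \<in> X}" "F \<in> {X \<in> S. v' \<in> X}"
  shows "attaches (restore ` T) (restore F)"
proof -
  let ?f = "\<lambda>x. if x = v'' then v else x"
  have "attaches ((\<lambda>A. A - {v'}) ` T) (F - {v'})"
    using assms finite_face_suspension by (intro attaches_Diff_vertex) auto
  \<comment> \<open>The renaming merges \<open>v''\<close> with \<open>v\<close>, so it is injective
    only away from \<open>v\<close>; faces of the suspension never contain \<open>v\<close>.\<close>
  moreover have "inj_on ?f (- {v})"
    by (auto simp: inj_on_def)
  ultimately have "attaches ((`) ?f ` (\<lambda>A. A - {v'}) ` T) (?f ` (F - {v'}))"
    by (rule attaches_image) (use assms in \<open>auto simp: mem_suspension_iff\<close>)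
  then show ?thesis
    unfolding image_image restore_def[abs_def] .
qed

theorem shellable_suspension: "shellable S \<longleftrightarrow> shellable K"
proof -
  have pure: "(\<exists>m. pure_of_dim m S) \<longleftrightarrow> (\<exists>m. pure_of_dim m K)"
    \<comment> \<open>Every integer \<open>m\<close> is \<open>(m - 1) + 1\<close>, so the dimension
      shift covers both directions.\<close>
    by (metis pure_suspension diff_add_cancel)
  have "(\<exists>Gs. distinct Gs \<and> set Gs = facets S \<and> shelling Gs) \<longleftrightarrow>
        (\<exists>Fs. distinct Fs \<and> set Fs = facets K \<and> shelling Fs)"
  proof (intro iffI; elim exE conjE)
    fix Gs assume Gs: "distinct Gs" "set Gs = facets S" "shelling Gs"
    \<comment> \<open>Only the facets through \<open>v'\<close> are kept: they shell its star, and
      \<open>restore\<close> turns them into the facets of \<open>K\<close>.\<close>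
    let ?Gs = "filter (\<lambda>X. v' \<in> X) Gs"
    have set: "set ?Gs = {X \<in> facets S. v' \<in> X}" using Gs by auto
    have "shelling (map restore ?Gs)"
    proof (rule shelling_map)
      show "shelling ?Gs" by (rule shelling_filter_mem[OF Gs(3)])
    next
      fix T F assume "attaches T F" "T \<subseteq> set ?Gs" "F \<in> set ?Gs"
      then show "attaches (restore ` T) (restore F)"
        unfolding set by (intro attaches_restore) (auto simp: facets_def)
    qed
    moreover have "distinct (map restore ?Gs)" "set (map restore ?Gs) = facets K"
      using restore_facets Gs(1) set unfolding bij_betw_def distinct_map set_map by auto
    ultimately show "\<exists>Fs. distinct Fs \<and> set Fs = facets K \<and> shelling Fs" by blast
  next
    fix Fs assume Fs: "distinct Fs" "set Fs = facets K" "shelling Fs"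
    then have "set Fs \<subseteq> K" by (auto simp: facets_def)
    with Fs show "\<exists>Gs. distinct Gs \<and> set Gs = facets S \<and> shelling Gs"
      by (intro exI[of _ "concat (map copies Fs)"])
        (simp add: distinct_copies shelling_copies facets_suspension)
  qed
  with pure show ?thesis
    by (simp add: shellable_iff_shelling finite_face finite_face_suspension)
qed

end

theorem proposition4p3:
  fixes K :: "'a set set" and v v' v'' :: 'a
  assumes "simplicial_complex K"
    and "{v} \<in> K"
    and "v' \<notin> \<Union>K" and "v'' \<notin> \<Union>K" and "v' \<noteq> v''"
  shows "shellable (one_point_suspension v' v'' v K) \<longleftrightarrow> shellable K"
proof -
  interpret suspension_data K v v' v''
    using assms by unfold_locales
  show ?thesis by (rule shellable_suspension)
qed

end
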